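(* Let $g\in\mathcal{B}$ be non-constant, let $h\in H(\mathbb{D})$ and let $\gamma>0$. The following three properties are equivalent. (i) The multiplication operator $M_h\colon[V_g,A^{-\gamma}]\to[V_g,A^{-\gamma}]$ exists as a linear map (i.e. $hf\in[V_g,A^{-\gamma}]$ for all $f\in[V_g,A^{-\gamma}]$) and is continuous. (ii) The multiplication operator $M_h\colon[V_g,A^{-\gamma}_0]\to[V_g,A^{-\gamma}_0]$ exists as a linear map (i.e. $hf\in[V_g,A^{-\gamma}_0]$ for all $f\in[V_g,A^{-\gamma}_0]$) and is continuous. (iii) $h\in H^\infty$. In this case, the norms $\|M_h\|_{[V_g,A^{-\gamma}]\to[V_g,A^{-\gamma}]}$ and $\|h\|_\infty$ are equivalent; that is, there exist constants $c,C>0$ independent of $h$ such that $c\|h\|_\infty\le\|M_h\|_{[V_g,A^{-\gamma}]\to[V_g,A^{-\gamma}]}\le C\|h\|_\infty$ for all $h\in H^\infty$.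
   Context: $\mathbb{D}$ is the open unit disc in $\mathbb{C}$, $H(\mathbb{D})$ is the space of analytic functions on $\mathbb{D}$, and $H^\infty$ is the space of bounded functions in $H(\mathbb{D})$ with the sup-norm $\|\cdot\|_\infty$. $M_hf:=hf$ denotes pointwise multiplication by $h$, and $\|M_h\|_{E\to E}$ is its operator norm on a normed space $E$. For $\gamma>0$, $A^{-\gamma}:=\{f\in H(\mathbb{D}): \|f\|_{-\gamma}:=\sup_{z\in\mathbb{D}}(1-|z|)^\gamma|f(z)|<\infty\}$ and $A^{-\gamma}_0:=\{f\in H(\mathbb{D}): \lim_{|z|\to1^-}(1-|z|)^\gamma|f(z)|=0\}$, both Banach spaces with norm $\|\cdot\|_{-\gamma}$. The Bloch space is $\mathcal{B}:=\{g\in H(\mathbb{D}): \sup_{z\in\mathbb{D}}(1-|z|)|g'(z)|<\infty\}$. The Volterra operator is $(V_gf)(z):=\int_0^zf(\xi)g'(\xi)\,d\xi$ for $f\in H(\mathbb{D})$, $z\in\mathbb{D}$. The optimal domains are $[V_g,A^{-\gamma}]:=\{f\in H(\mathbb{D}): V_gf\in A^{-\gamma}\}$ and $[V_g,A^{-\gamma}_0]:=\{f\in H(\mathbb{D}): V_gf\in A^{-\gamma}_0\}$, each endowed with the norm $f\mapsto\|V_gf\|_{-\gamma}$. *)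

theory Defs
  imports "HOL-Complex_Analysis.Complex_Analysis"
begin

text \<open>
  A function on the open unit disc is represented by a total function on the complex numbers of
  which only the values on \<^term>\<open>ball 0 1 :: complex set\<close> matter: every notion below depends on
  these values alone, and two functions that agree on the disc represent the same element.
\<close>

abbreviation disc :: "complex set" where
  "disc \<equiv> ball 0 1"

definition H_disc :: "(complex \<Rightarrow> complex) set" where
  "H_disc = {f. f holomorphic_on disc}"

definition H_inf :: "(complex \<Rightarrow> complex) set" where
  "H_inf = {f \<in> H_disc. bounded (f ` disc)}"

definition sup_norm :: "(complex \<Rightarrow> complex) \<Rightarrow> real" where
  "sup_norm f = (SUP z\<in>disc. norm (f z))"

definition growth_space :: "real \<Rightarrow> (complex \<Rightarrow> complex) set" where
  "growth_space \<gamma> =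
     {f \<in> H_disc. bdd_above ((\<lambda>z. (1 - norm z) powr \<gamma> * norm (f z)) ` disc)}"

definition growth_norm :: "real \<Rightarrow> (complex \<Rightarrow> complex) \<Rightarrow> real" where
  "growth_norm \<gamma> f = (SUP z\<in>disc. (1 - norm z) powr \<gamma> * norm (f z))"

text \<open>The filter \<^term>\<open>filtercomap norm (at_left (1 :: real)) :: complex filter\<close> expresses
  that \<open>\<bar>z\<bar>\<close> tends to 1 from below.\<close>

definition little_growth_space :: "real \<Rightarrow> (complex \<Rightarrow> complex) set" where
  "little_growth_space \<gamma> =
     {f \<in> H_disc. ((\<lambda>z. (1 - norm z) powr \<gamma> * norm (f z)) \<longlongrightarrow> 0)
                    (filtercomap norm (at_left 1))}"

definition bloch_space :: "(complex \<Rightarrow> complex) set" where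
  "bloch_space =
     {g \<in> H_disc. bdd_above ((\<lambda>z. (1 - norm z) * norm (deriv g z)) ` disc)}"

definition volterra :: "(complex \<Rightarrow> complex) \<Rightarrow> (complex \<Rightarrow> complex) \<Rightarrow> complex \<Rightarrow> complex" where
  "volterra g f = (\<lambda>z. contour_integral (linepath 0 z) (\<lambda>\<xi>. f \<xi> * deriv g \<xi>))"

definition optimal_domain ::
    "(complex \<Rightarrow> complex) \<Rightarrow> (complex \<Rightarrow> complex) set \<Rightarrow> (complex \<Rightarrow> complex) set" where
  "optimal_domain g X = {f \<in> H_disc. volterra g f \<in> X}"

definition optimal_norm :: "(complex \<Rightarrow> complex) \<Rightarrow> real \<Rightarrow> (complex \<Rightarrow> complex) \<Rightarrow> real" where
  "optimal_norm g \<gamma> f = growth_norm \<gamma> (volterra g f)"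

definition mult_op :: "(complex \<Rightarrow> complex) \<Rightarrow> (complex \<Rightarrow> complex) \<Rightarrow> complex \<Rightarrow> complex" where
  "mult_op h f = (\<lambda>z. h z * f z)"

text \<open>Continuity and operator norm of a self-map \<open>T\<close> of a function space \<open>E\<close> with norm \<open>N\<close>.
  The value of \<open>op_norm_on\<close> is meaningful only if the supremum is finite, that is, for bounded
  (equivalently, for linear \<open>T\<close>, continuous) operators.\<close>

definition continuous_op_on ::
    "(complex \<Rightarrow> complex) set \<Rightarrow> ((complex \<Rightarrow> complex) \<Rightarrow> real) \<Rightarrow>
     ((complex \<Rightarrow> complex) \<Rightarrow> complex \<Rightarrow> complex) \<Rightarrow> bool" where
  "continuous_op_on E N T \<longleftrightarrow>
     (\<forall>f\<in>E. \<forall>\<epsilon>>0. \<exists>\<delta>>0. \<forall>f'\<in>E.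
        N (\<lambda>z. f' z - f z) < \<delta> \<longrightarrow> N (\<lambda>z. T f' z - T f z) < \<epsilon>)"

definition op_norm_on ::
    "(complex \<Rightarrow> complex) set \<Rightarrow> ((complex \<Rightarrow> complex) \<Rightarrow> real) \<Rightarrow>
     ((complex \<Rightarrow> complex) \<Rightarrow> complex \<Rightarrow> complex) \<Rightarrow> real" where
  "op_norm_on E N T = (SUP f\<in>{f \<in> E. N f \<le> 1}. N (T f))"

end

theory Submission
  imports Defs
begin

text \<open>
  Cauchy's estimate in one direction and integration along radii in the other show that
  \<open>V\<^sub>g f\<close> has growth of order \<open>\<gamma>\<close> if and only if its derivative \<open>f g'\<close> has growth of
  order \<open>\<gamma> + 1\<close>, with comparable norms; likewise for the little-o spaces. Both optimal domains
  are thus described by the size of \<open>\<bar>f g'\<bar>\<close> alone, so a bounded \<open>h\<close> acts boundedly on them.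
  Conversely, if \<open>M\<^sub>h\<close> is bounded by \<open>K\<close>, iterating it on the constant 1, which lies in both
  domains since \<open>g\<close> is a Bloch function, gives \<open>\<bar>h z\<bar>\<^sup>n * \<bar>g' z\<bar> \<le> C\<^sub>z * K\<^sup>n\<close> for all \<open>n\<close>, hence
  \<open>\<bar>h z\<bar> \<le> K\<close> wherever \<open>g' z\<close> is nonzero, and then everywhere by continuity.
\<close>

section \<open>Growth conditions as pointwise bounds\<close>

lemma one_minus_norm_pos: "z \<in> disc \<Longrightarrow> 0 < 1 - norm z"
  by simp

lemma powr_mult_le_iff:
  fixes r :: real
  assumes "0 < r"
  shows "r powr \<gamma> * a \<le> K \<longleftrightarrow> a \<le> K * r powr - \<gamma>"
  using assms by (simp add: powr_minus field_simps)

text \<open>The real supremum carries information only when it is taken over a bounded set, hence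
  the membership hypothesis. Moving the weight to the right gives the form in which derivatives and
  integrals are estimated.\<close>

lemma growth_norm_le_iff:
  assumes "f \<in> growth_space \<gamma>"
  shows "growth_norm \<gamma> f \<le> K \<longleftrightarrow> (\<forall>z\<in>disc. norm (f z) \<le> K * (1 - norm z) powr - \<gamma>)"
proof -
  have "growth_norm \<gamma> f \<le> K \<longleftrightarrow> (\<forall>z\<in>disc. (1 - norm z) powr \<gamma> * norm (f z) \<le> K)"
    unfolding growth_norm_def using assms
    by (intro cSUP_le_iff) (auto simp: growth_space_def)
  then show ?thesis
    by (simp add: powr_mult_le_iff)
qed

lemma growth_space_iff:
  "f \<in> growth_space \<gamma> \<longleftrightarrow>
     f \<in> H_disc \<and> (\<exists>K. \<forall>z\<in>disc. norm (f z) \<le> K * (1 - norm z) powr - \<gamma>)"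
  by (auto simp: growth_space_def bdd_above_def powr_mult_le_iff)

lemma holomorphic_bounded_cball:
  assumes "f \<in> H_disc" "R < 1"
  shows "\<exists>M\<ge>0. \<forall>z. norm z \<le> R \<longrightarrow> norm (f z) \<le> M"
proof -
  have "continuous_on (cball 0 R) f"
    using assms unfolding H_disc_def
    by (intro holomorphic_on_imp_continuous_on) (auto elim: holomorphic_on_subset)
  then have "bounded (f ` cball 0 R)"
    by (intro compact_imp_bounded compact_continuous_image) auto
  then show ?thesis
    by (auto simp: bounded_pos intro: less_imp_le)
qed

text \<open>Unlike the limit, this form of the little-o condition can be integrated and differentiated
  by the same estimates as the plain growth condition.\<close>

lemma little_growth_space_iff:
  assumes "0 < \<gamma>"
  shows "f \<in> little_growth_space \<gamma> \<longleftrightarrow>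
     f \<in> H_disc \<and> (\<forall>\<epsilon>>0. \<exists>M. \<forall>z\<in>disc. norm (f z) \<le> M + \<epsilon> * (1 - norm z) powr - \<gamma>)"
proof (intro iffI conjI allI impI)
  assume f: "f \<in> little_growth_space \<gamma>"
  then show H: "f \<in> H_disc"
    by (simp add: little_growth_space_def)
  fix \<epsilon> :: real
  assume "0 < \<epsilon>"
  with f have "\<forall>\<^sub>F z in filtercomap norm (at_left 1). \<bar>(1 - norm z) powr \<gamma> * norm (f z)\<bar> < \<epsilon>"
    by (auto simp: little_growth_space_def tendsto_iff dist_real_def)
  then obtain R where R: "R < 1" "\<And>z. R < norm z \<Longrightarrow> norm z < 1 \<Longrightarrow> (1 - norm z) powr \<gamma> * norm (f z) < \<epsilon>"
    by (auto simp: eventually_filtercomap eventually_at_left_field abs_mult)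
  \<comment> \<open>Beyond radius \<open>R\<close> the weighted bound holds; on the compact rest
    continuity supplies the constant.\<close>
  obtain M where M: "M \<ge> 0" "\<And>z. norm z \<le> R \<Longrightarrow> norm (f z) \<le> M"
    using holomorphic_bounded_cball[OF H R(1)] by blast
  have "norm (f z) \<le> M + \<epsilon> * (1 - norm z) powr - \<gamma>" if z: "z \<in> disc" for z
  proof (cases "norm z \<le> R")
    case True
    with M(2) \<open>0 < \<epsilon>\<close> show ?thesis by (smt (verit) mult_nonneg_nonneg powr_ge_zero)
  next
    case False
    then have "norm (f z) \<le> \<epsilon> * (1 - norm z) powr - \<gamma>"
      using R(2)[of z] z powr_mult_le_iff[of "1 - norm z" \<gamma> "norm (f z)" \<epsilon>] by simp
    with M(1) show ?thesis by simp
  qed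
  then show "\<exists>M. \<forall>z\<in>disc. norm (f z) \<le> M + \<epsilon> * (1 - norm z) powr - \<gamma>"
    by blast
next
  assume f: "f \<in> H_disc \<and> (\<forall>\<epsilon>>0. \<exists>M. \<forall>z\<in>disc. norm (f z) \<le> M + \<epsilon> * (1 - norm z) powr - \<gamma>)"
  have "((\<lambda>z. (1 - norm z) powr \<gamma> * norm (f z)) \<longlongrightarrow> 0) (filtercomap norm (at_left 1))"
  proof (rule tendstoI)
    fix \<epsilon> :: real
    assume "0 < \<epsilon>"
    then obtain M where M: "\<And>z. z \<in> disc \<Longrightarrow> norm (f z) \<le> M + \<epsilon> / 2 * (1 - norm z) powr - \<gamma>"
      using f half_gt_zero by blast
    \<comment> \<open>Since \<gamma> > 0, the weight tends to 0 at the boundary, so the fixed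
      \<open>M\<close> costs less than the second half of \<epsilon>.\<close>
    have "((\<lambda>r. (1 - r) powr \<gamma> * M) \<longlongrightarrow> (1 - 1) powr \<gamma> * M) (at_left (1 :: real))"
      by (intro tendsto_intros) (auto simp: assms eventually_at_left_field intro!: exI[of _ 0])
    then have "((\<lambda>r. (1 - r) powr \<gamma> * M) \<longlongrightarrow> 0) (at_left (1 :: real))"
      by simp
    then have "\<forall>\<^sub>F r in at_left (1 :: real). (1 - r) powr \<gamma> * M < \<epsilon> / 2"
      using \<open>0 < \<epsilon>\<close> by (intro order_tendstoD(2)) auto
    moreover have "\<forall>\<^sub>F r in at_left (1 :: real). r < 1"
      by (simp add: eventually_at_filter)
    ultimately have "\<forall>\<^sub>F r in at_left (1 :: real). r < 1 \<and> (1 - r) powr \<gamma> * M < \<epsilon> / 2"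
      by eventually_elim simp
    then have "\<forall>\<^sub>F z :: complex in filtercomap norm (at_left 1).
        norm z < 1 \<and> (1 - norm z) powr \<gamma> * M < \<epsilon> / 2"
      by (rule eventually_filtercomapI)
    then show "\<forall>\<^sub>F z in filtercomap norm (at_left 1).
        dist ((1 - norm z) powr \<gamma> * norm (f z)) 0 < \<epsilon>"
    proof eventually_elim
      case (elim z)
      then have "(1 - norm z) powr \<gamma> * norm (f z)
          \<le> (1 - norm z) powr \<gamma> * (M + \<epsilon> / 2 * (1 - norm z) powr - \<gamma>)"
        by (intro mult_left_mono M) auto
      also have "\<dots> = (1 - norm z) powr \<gamma> * M + \<epsilon> / 2"
        using elim by (simp add: algebra_simps flip: powr_add)
      finally show ?case
        using elim by simp
    qed
  qed
  with f show "f \<in> little_growth_space \<gamma>"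
    by (simp add: little_growth_space_def)
qed

text \<open>Take \<epsilon> = 1 in the pointwise form; the additive constant is absorbed because (1
  - |z|) powr -\<gamma> is at least 1 on the disc.\<close>

lemma little_growth_space_subset:
  assumes "0 < \<gamma>"
  shows "little_growth_space \<gamma> \<subseteq> growth_space \<gamma>"
proof
  fix f assume f: "f \<in> little_growth_space \<gamma>"
  then obtain M where M: "\<And>z. z \<in> disc \<Longrightarrow> norm (f z) \<le> M + 1 * (1 - norm z) powr - \<gamma>"
    unfolding little_growth_space_iff[OF assms] using zero_less_one by blast
  have "norm (f z) \<le> (\<bar>M\<bar> + 1) * (1 - norm z) powr - \<gamma>" if z: "z \<in> disc" for z
  proof -
    have "1 \<le> (1 - norm z) powr - \<gamma>"
      using z assms by (simp add: powr_minus one_le_inverse_iff powr_le1)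
    then have "M \<le> \<bar>M\<bar> * (1 - norm z) powr - \<gamma>"
      using mult_left_mono[of 1 "(1 - norm z) powr - \<gamma>" "\<bar>M\<bar>"] by simp
    with M[OF z] show ?thesis
      by (simp add: algebra_simps)
  qed
  with f show "f \<in> growth_space \<gamma>"
    unfolding growth_space_iff little_growth_space_def by blast
qed

section \<open>The Volterra operator as a primitive\<close>

lemma holomorphic_volterra_integrand:
  assumes "f \<in> H_disc" "g \<in> H_disc"
  shows "(\<lambda>\<xi>. f \<xi> * deriv g \<xi>) holomorphic_on disc"
  using assms by (auto simp: H_disc_def intro!: holomorphic_intros)

lemma volterra_0 [simp]: "volterra g f 0 = 0"
  by (simp add: volterra_def)

text \<open>The disc is convex, so the holomorphic integrand has a primitive \<open>G\<close>, and
  integrating along the segment from 0 gives \<open>G w - G 0\<close>.\<close>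

lemma has_field_derivative_volterra:
  assumes "f \<in> H_disc" "g \<in> H_disc" "z \<in> disc"
  shows "(volterra g f has_field_derivative f z * deriv g z) (at z)"
proof -
  obtain G where G: "\<And>w. w \<in> disc \<Longrightarrow> (G has_field_derivative f w * deriv g w) (at w within disc)"
    using holomorphic_convex_primitive'[OF convex_ball open_ball holomorphic_volterra_integrand[OF assms(1,2)]]
    by metis
  have "G w - G 0 = volterra g f w" if "w \<in> disc" for w
  proof -
    have "closed_segment 0 w \<subseteq> disc"
      using that by (intro closed_segment_subset) auto
    then show ?thesis
      using contour_integral_primitive[of disc G _ "linepath 0 w", OF G]
      by (simp add: volterra_def contour_integral_unique)
  qed
  moreover have "((\<lambda>w. G w - G 0) has_field_derivative f z * deriv g z) (at z)"
    using DERIV_diff[OF G[OF assms(3)] DERIV_const[of "G 0"]]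
    by (simp add: at_within_open[OF assms(3) open_ball])
  ultimately show ?thesis
    using has_field_derivative_transform_within_open[OF _ open_ball assms(3)] by metis
qed

lemma volterra_in_H_disc:
  assumes "f \<in> H_disc" "g \<in> H_disc"
  shows "volterra g f \<in> H_disc"
  using has_field_derivative_volterra[OF assms]
  unfolding H_disc_def holomorphic_on_open[OF open_ball] by blast

lemma volterra_scale:
  assumes "f \<in> H_disc" "g \<in> H_disc" "z \<in> disc"
  shows "volterra g (\<lambda>\<xi>. c * f \<xi>) z = c * volterra g f z"
proof -
  have "closed_segment 0 z \<subseteq> disc"
    using assms(3) by (intro closed_segment_subset) auto
  then have "(\<lambda>\<xi>. f \<xi> * deriv g \<xi>) contour_integrable_on linepath 0 z"
    using holomorphic_volterra_integrand[OF assms(1,2)]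
    by (intro contour_integrable_continuous_linepath holomorphic_on_imp_continuous_on)
       (rule holomorphic_on_subset)
  then show ?thesis
    by (simp add: volterra_def mult.assoc contour_integral_lmul)
qed

section \<open>Radial integration and Cauchy estimates\<close>

text \<open>The integrand is dominated along the radius to \<open>z\<close>. Keeping
  \<open>M\<close> apart from \<open>A\<close> serves both spaces: \<open>M = 0\<close> gives the
  plain growth bound, small \<open>A\<close> with arbitrary \<open>M\<close> the little-o
  one.\<close>

lemma norm_volterra_le:
  assumes fg: "f \<in> H_disc" "g \<in> H_disc" and "0 < \<gamma>" "0 \<le> M" "0 \<le> A"
    and bound: "\<And>w. w \<in> disc \<Longrightarrow> norm (f w * deriv g w) \<le> M + A * (1 - norm w) powr - (\<gamma> + 1)"
    and z: "z \<in> disc"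
  shows "norm (volterra g f z) \<le> M + A / \<gamma> * (1 - norm z) powr - \<gamma>"
proof -
  define F where "F t = volterra g f (of_real t * z)" for t :: real
  \<comment> \<open>A primitive in \<open>t\<close> of the assumed majorant along the radius,
    including the factor |z| from the chain rule.\<close>
  define \<phi> where "\<phi> t = M * (t * norm z) + A / \<gamma> * (1 - t * norm z) powr - \<gamma>" for t :: real
  have tz: "of_real t * z \<in> disc" "0 < 1 - t * norm z" if "0 \<le> t" "t \<le> 1" for t :: real
    using that z mult_right_mono[OF that(2) norm_ge_zero[of z]] by (auto simp: norm_mult)
  have dF: "(F has_vector_derivative z * (f (of_real t * z) * deriv g (of_real t * z))) (at t)"
    if "0 \<le> t" "t \<le> 1" for t
  proof -
    have "((\<lambda>w. volterra g f (w * z)) has_field_derivative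
        f (of_real t * z) * deriv g (of_real t * z) * z) (at (of_real t))"
      by (rule DERIV_chain2[where f = "volterra g f"])
        (use has_field_derivative_volterra[OF fg tz(1)[OF that]] in \<open>auto intro!: derivative_eq_intros\<close>)
    then show ?thesis
      unfolding F_def by (auto dest: has_vector_derivative_real_field simp: mult_ac)
  qed
  have d\<phi>: "(\<phi> has_vector_derivative norm z * (M + A * (1 - t * norm z) powr - (\<gamma> + 1))) (at t)"
    if "0 \<le> t" "t \<le> 1" for t
    unfolding \<phi>_def has_real_derivative_iff_has_vector_derivative [symmetric]
    using tz(2)[OF that] \<open>0 < \<gamma>\<close>
    by (auto intro!: derivative_eq_intros simp: field_simps powr_diff powr_minus powr_add)
  have "norm (F 1 - F 0) \<le> \<phi> 1 - \<phi> 0"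
  proof (rule differentiable_bound_general)
    show "continuous_on {0..1} F" "continuous_on {0..1} \<phi>"
      using dF d\<phi> by (auto intro!: continuous_at_imp_continuous_on has_vector_derivative_continuous)
    fix t :: real
    assume t: "0 < t" "t < 1"
    then show "(F has_vector_derivative z * (f (of_real t * z) * deriv g (of_real t * z))) (at t)"
      and "(\<phi> has_vector_derivative norm z * (M + A * (1 - t * norm z) powr - (\<gamma> + 1))) (at t)"
      using dF[of t] d\<phi>[of t] by simp_all
    show "norm (z * (f (of_real t * z) * deriv g (of_real t * z)))
        \<le> norm z * (M + A * (1 - t * norm z) powr - (\<gamma> + 1))"
      using mult_left_mono[OF bound[OF tz(1)[of t]] norm_ge_zero[of z]] t
      by (simp add: norm_mult)
  qed simp
  moreover have "0 \<le> A / \<gamma>" "M * norm z \<le> M"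
    using assms by (auto intro: mult_left_le)
  ultimately show ?thesis
    by (simp add: F_def \<phi>_def)
qed

text \<open>Cauchy's inequality on the circle about \<open>z\<close> of radius \<open>r\<close>,
  half the distance to the boundary: there 1 - |w| is still at least \<open>r\<close>. Halving the
  distance costs 2 powr \<gamma> in the weight and another 2 in the division by
  \<open>r\<close>.\<close>

lemma norm_deriv_le:
  assumes F: "F \<in> H_disc" and "0 < \<gamma>" "0 \<le> M" "0 \<le> A"
    and bound: "\<And>w. w \<in> disc \<Longrightarrow> norm (F w) \<le> M + A * (1 - norm w) powr - \<gamma>"
    and z: "z \<in> disc"
  shows "norm (deriv F z) \<le>
    2 * M * (1 - norm z) powr - 1 + 2 powr (\<gamma> + 1) * A * (1 - norm z) powr - (\<gamma> + 1)"
proof -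
  define r where "r = (1 - norm z) / 2"
  have r: "0 < r" using z by (simp add: r_def)
  have near: "norm w \<le> 1 - r" if "w \<in> cball z r" for w
    using that norm_triangle_ineq2[of w z] by (simp add: r_def dist_norm norm_minus_commute field_simps)
  then have sub: "cball z r \<subseteq> disc"
    using r by force
  have "norm ((deriv ^^ 1) F z) \<le> fact 1 * (M + A * r powr - \<gamma>) / r ^ 1"
  proof (rule Cauchy_inequality)
    show "F holomorphic_on ball z r" "continuous_on (cball z r) F"
      using F sub ball_subset_cball[of z r] unfolding H_disc_def
      by (blast intro: holomorphic_on_subset holomorphic_on_imp_continuous_on)+
    fix w assume "norm (z - w) = r"
    then have w: "w \<in> cball z r" by (simp add: dist_norm)
    then have "(1 - norm w) powr - \<gamma> \<le> r powr - \<gamma>"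
      using near[OF w] r \<open>0 < \<gamma>\<close> by (intro powr_mono2') auto
    then have "A * (1 - norm w) powr - \<gamma> \<le> A * r powr - \<gamma>"
      using \<open>0 \<le> A\<close> by (rule mult_left_mono)
    with bound[of w] sub w show "norm (F w) \<le> M + A * r powr - \<gamma>"
      by fastforce
  qed (use r in auto)
  also have "fact 1 * (M + A * r powr - \<gamma>) / r ^ 1 =
    2 * M * (1 - norm z) powr - 1 + 2 powr (\<gamma> + 1) * A * (1 - norm z) powr - (\<gamma> + 1)"
  proof -
    define s where "s = 1 - norm z"
    have s: "0 < s" "r = s / 2" using z by (auto simp: s_def r_def)
    have "s powr - (\<gamma> + 1) = s powr - \<gamma> / s"
      using s by (simp add: powr_diff)
    moreover have "r powr - \<gamma> = 2 powr \<gamma> * s powr - \<gamma>"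
      unfolding s(2) using s(1) by (simp add: powr_divide powr_minus field_simps)
    moreover have "s powr - 1 = 1 / s"
      using s by (simp add: powr_minus field_simps)
    ultimately show ?thesis
      using s(1) unfolding s_def[symmetric] s(2) by (simp add: powr_add field_simps)
  qed
  finally show ?thesis
    by simp
qed

text \<open>Because \<gamma> > 0, 1/r is of smaller order than r powr -(\<gamma> + 1) as r tends to
  0. This absorbs the 1/(1 - |z|) terms that come from Cauchy's estimate and from the Bloch
  condition.\<close>

lemma inverse_le_eps_powr:
  fixes \<gamma> \<epsilon> M :: real
  assumes "0 < \<gamma>" "0 \<le> M" "0 < \<epsilon>"
  shows "\<exists>M'\<ge>0. \<forall>r>0. M * r powr - 1 \<le> M' + \<epsilon> * r powr - (\<gamma> + 1)"
proof -
  \<comment> \<open>Up to this threshold \<open>M * r powr \<gamma> \<le> \<epsilon>\<close>, and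
    beyond it 1/r is bounded by 1/\<rho>. The denominator \<open>M + 1\<close> is positive even for
    \<open>M = 0\<close>.\<close>
  define \<rho> where "\<rho> = (\<epsilon> / (M + 1)) powr (1 / \<gamma>)"
  have \<rho>: "0 < \<rho>" "\<rho> powr \<gamma> = \<epsilon> / (M + 1)"
    using assms by (auto simp: \<rho>_def powr_powr)
  have "M * r powr - 1 \<le> M / \<rho> + \<epsilon> * r powr - (\<gamma> + 1)" if r: "0 < r" for r
  proof (cases "r \<le> \<rho>")
    case True
    then have "r powr \<gamma> \<le> \<epsilon> / (M + 1)"
      using r assms powr_mono2[of \<gamma> r \<rho>] by (simp add: \<rho>)
    then have "M * r powr \<gamma> \<le> \<epsilon>"
      using assms by (simp add: field_simps) (smt (verit) powr_ge_zero)
    then have "M * r powr \<gamma> * r powr - (\<gamma> + 1) \<le> \<epsilon> * r powr - (\<gamma> + 1)"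
      by (intro mult_right_mono) auto
    moreover have "M * r powr \<gamma> * r powr - (\<gamma> + 1) = M * r powr - 1"
      by (simp add: mult.assoc flip: powr_add)
    ultimately show ?thesis
      using assms \<rho>(1) by (smt (verit) divide_nonneg_nonneg)
  next
    case False
    then have "M * r powr - 1 \<le> M / \<rho>"
      using r \<rho>(1) assms by (simp add: powr_minus field_simps mult_left_mono)
    then show ?thesis
      using assms by (smt (verit) mult_nonneg_nonneg powr_ge_zero)
  qed
  then show ?thesis
    using assms \<rho>(1) by (intro exI[of _ "M / \<rho>"]) auto
qed

section \<open>Optimal domains described by the size of f g'\<close>

lemma deriv_volterra:
  assumes "f \<in> H_disc" "g \<in> H_disc" "z \<in> disc"
  shows "deriv (volterra g f) z = f z * deriv g z"
  using has_field_derivative_volterra[OF assms] by (rule DERIV_imp_deriv)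

lemma growth_norm_nonneg:
  assumes "f \<in> growth_space \<gamma>"
  shows "0 \<le> growth_norm \<gamma> f"
proof -
  have "norm (f 0) \<le> growth_norm \<gamma> f * (1 - norm (0 :: complex)) powr - \<gamma>"
    using growth_norm_le_iff[OF assms, THEN iffD1, OF order_refl, rule_format, of 0] by simp
  then show ?thesis
    by (simp add: order_trans[OF norm_ge_zero])
qed

text \<open>The Cauchy estimate for \<open>volterra g f\<close>, whose derivative is f g', with
  additive constant 0.\<close>

lemma norm_mult_deriv_le_optimal_norm:
  assumes "g \<in> H_disc" "0 < \<gamma>" "f \<in> optimal_domain g (growth_space \<gamma>)" "z \<in> disc"
  shows "norm (f z * deriv g z)
    \<le> 2 powr (\<gamma> + 1) * optimal_norm g \<gamma> f * (1 - norm z) powr - (\<gamma> + 1)"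
proof -
  have f: "f \<in> H_disc" "volterra g f \<in> growth_space \<gamma>"
    using assms by (auto simp: optimal_domain_def)
  have "norm (deriv (volterra g f) z) \<le> 2 * 0 * (1 - norm z) powr - 1 +
      2 powr (\<gamma> + 1) * optimal_norm g \<gamma> f * (1 - norm z) powr - (\<gamma> + 1)"
  proof (rule norm_deriv_le)
    fix w assume "w \<in> disc"
    then show "norm (volterra g f w) \<le> 0 + optimal_norm g \<gamma> f * (1 - norm w) powr - \<gamma>"
      using growth_norm_le_iff[OF f(2), of "growth_norm \<gamma> (volterra g f)"]
      by (simp add: optimal_norm_def)
  qed (use assms f in \<open>auto simp: volterra_in_H_disc optimal_norm_def growth_norm_nonneg\<close>)
  then show ?thesis
    using deriv_volterra[OF f(1) assms(1,4)] by simp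
qed

lemma optimal_domain_growth_iff:
  assumes "g \<in> H_disc" "0 < \<gamma>"
  shows "f \<in> optimal_domain g (growth_space \<gamma>) \<longleftrightarrow>
    f \<in> H_disc \<and> (\<exists>A\<ge>0. \<forall>z\<in>disc. norm (f z * deriv g z) \<le> A * (1 - norm z) powr - (\<gamma> + 1))"
proof (intro iffI conjI)
  assume f: "f \<in> optimal_domain g (growth_space \<gamma>)"
  then show "f \<in> H_disc" by (simp add: optimal_domain_def)
  have "0 \<le> optimal_norm g \<gamma> f"
    using f by (auto simp: optimal_norm_def optimal_domain_def growth_norm_nonneg)
  then show "\<exists>A\<ge>0. \<forall>z\<in>disc. norm (f z * deriv g z) \<le> A * (1 - norm z) powr - (\<gamma> + 1)"
    using norm_mult_deriv_le_optimal_norm[OF assms f]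
    by (intro exI[of _ "2 powr (\<gamma> + 1) * optimal_norm g \<gamma> f"]) auto
next
  assume f: "f \<in> H_disc \<and>
    (\<exists>A\<ge>0. \<forall>z\<in>disc. norm (f z * deriv g z) \<le> A * (1 - norm z) powr - (\<gamma> + 1))"
  then obtain A where A: "0 \<le> A"
    "\<And>z. z \<in> disc \<Longrightarrow> norm (f z * deriv g z) \<le> 0 + A * (1 - norm z) powr - (\<gamma> + 1)"
    by auto
  have "norm (volterra g f z) \<le> A / \<gamma> * (1 - norm z) powr - \<gamma>" if "z \<in> disc" for z
    using norm_volterra_le[of f g \<gamma> 0 A z] f assms A that by auto
  then show "f \<in> optimal_domain g (growth_space \<gamma>)"
    using f assms volterra_in_H_disc unfolding optimal_domain_def growth_space_iff by blast
qed

text \<open>Radial integration in quantitative form; together with the preceding Cauchy bound it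
  makes the optimal norm comparable to a weighted supremum of |f g'|.\<close>

lemma optimal_norm_le:
  assumes "g \<in> H_disc" "0 < \<gamma>" "f \<in> H_disc" "0 \<le> A"
    and "\<And>z. z \<in> disc \<Longrightarrow> norm (f z * deriv g z) \<le> A * (1 - norm z) powr - (\<gamma> + 1)"
  shows "optimal_norm g \<gamma> f \<le> A / \<gamma>"
proof -
  have "f \<in> optimal_domain g (growth_space \<gamma>)"
    using assms by (auto simp: optimal_domain_growth_iff)
  then have "volterra g f \<in> growth_space \<gamma>"
    by (simp add: optimal_domain_def)
  moreover have "norm (volterra g f z) \<le> A / \<gamma> * (1 - norm z) powr - \<gamma>" if "z \<in> disc" for z
    using norm_volterra_le[of f g \<gamma> 0 A z] assms that by auto
  ultimately show ?thesis
    by (simp add: optimal_norm_def growth_norm_le_iff)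
qed

lemma optimal_domain_little_growth_iff:
  assumes "g \<in> H_disc" "0 < \<gamma>"
  shows "f \<in> optimal_domain g (little_growth_space \<gamma>) \<longleftrightarrow> f \<in> H_disc \<and>
    (\<forall>\<epsilon>>0. \<exists>M\<ge>0. \<forall>z\<in>disc. norm (f z * deriv g z) \<le> M + \<epsilon> * (1 - norm z) powr - (\<gamma> + 1))"
proof (intro iffI conjI allI impI)
  assume f: "f \<in> optimal_domain g (little_growth_space \<gamma>)"
  then show H: "f \<in> H_disc" by (simp add: optimal_domain_def)
  fix \<epsilon> :: real
  assume "0 < \<epsilon>"
  \<comment> \<open>Chosen so that after the Cauchy factor 2 powr (\<gamma> + 1) only \<epsilon>/2
    is spent; the other half absorbs the term in 1/(1 - |z|).\<close>
  define \<epsilon>' where "\<epsilon>' = \<epsilon> / 2 / 2 powr (\<gamma> + 1)"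
  have \<epsilon>': "0 < \<epsilon>'" "2 powr (\<gamma> + 1) * \<epsilon>' = \<epsilon> / 2"
    using \<open>0 < \<epsilon>\<close> by (auto simp: \<epsilon>'_def)
  obtain M where M: "\<And>z. z \<in> disc \<Longrightarrow> norm (volterra g f z) \<le> M + \<epsilon>' * (1 - norm z) powr - \<gamma>"
    using f \<epsilon>'(1) assms unfolding optimal_domain_def little_growth_space_iff[OF assms(2)] by blast
  obtain M' where M': "M' \<ge> 0" "\<And>r. r > 0 \<Longrightarrow> 2 * \<bar>M\<bar> * r powr - 1 \<le> M' + \<epsilon> / 2 * r powr - (\<gamma> + 1)"
    using inverse_le_eps_powr[of \<gamma> "2 * \<bar>M\<bar>" "\<epsilon> / 2"] assms \<open>0 < \<epsilon>\<close> by auto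
  have "norm (f z * deriv g z) \<le> M' + \<epsilon> * (1 - norm z) powr - (\<gamma> + 1)" if z: "z \<in> disc" for z
  proof -
    have "norm (deriv (volterra g f) z) \<le> 2 * \<bar>M\<bar> * (1 - norm z) powr - 1 +
      2 powr (\<gamma> + 1) * \<epsilon>' * (1 - norm z) powr - (\<gamma> + 1)"
      using assms H \<epsilon>'(1) z
      by (intro norm_deriv_le volterra_in_H_disc order_trans[OF M]) auto
    then show ?thesis
      using M'(2)[of "1 - norm z"] z deriv_volterra[OF H assms(1) z] by (simp add: \<epsilon>'(2))
  qed
  then show "\<exists>M\<ge>0. \<forall>z\<in>disc. norm (f z * deriv g z) \<le> M + \<epsilon> * (1 - norm z) powr - (\<gamma> + 1)"
    using M'(1) by blast
next
  assume f: "f \<in> H_disc \<and>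
    (\<forall>\<epsilon>>0. \<exists>M\<ge>0. \<forall>z\<in>disc. norm (f z * deriv g z) \<le> M + \<epsilon> * (1 - norm z) powr - (\<gamma> + 1))"
  have "\<exists>M. \<forall>z\<in>disc. norm (volterra g f z) \<le> M + \<epsilon> * (1 - norm z) powr - \<gamma>" if "0 < \<epsilon>" for \<epsilon>
  proof -
    \<comment> \<open>The factor \<gamma> cancels the division by \<gamma> that radial integration
      produces.\<close>
    have "0 < \<epsilon> * \<gamma>"
      using assms that by simp
    then obtain M where M: "0 \<le> M" "\<And>z. z \<in> disc \<Longrightarrow>
        norm (f z * deriv g z) \<le> M + \<epsilon> * \<gamma> * (1 - norm z) powr - (\<gamma> + 1)"
      using f by blast
    have "norm (volterra g f z) \<le> M + \<epsilon> * \<gamma> / \<gamma> * (1 - norm z) powr - \<gamma>" if "z \<in> disc" for z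
      using f assms M that \<open>0 < \<epsilon> * \<gamma>\<close> by (intro norm_volterra_le) auto
    moreover have "\<epsilon> * \<gamma> / \<gamma> = \<epsilon>"
      using assms by simp
    ultimately show ?thesis
      by metis
  qed
  then show "f \<in> optimal_domain g (little_growth_space \<gamma>)"
    using f assms volterra_in_H_disc unfolding optimal_domain_def little_growth_space_iff[OF assms(2)]
    by blast
qed

text \<open>For f = 1 the product f g' is g' itself, which the Bloch condition bounds by a multiple
  of 1/(1 - |z|), and this is of smaller order than (1 - |z|) powr -(\<gamma> + 1).\<close>

lemma one_in_optimal_domain:
  assumes "g \<in> bloch_space" "0 < \<gamma>"
  shows "(\<lambda>_. 1) \<in> optimal_domain g (little_growth_space \<gamma>)"
proof -
  have g: "g \<in> H_disc" using assms by (simp add: bloch_space_def)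
  obtain K where K: "\<And>z. z \<in> disc \<Longrightarrow> (1 - norm z) * norm (deriv g z) \<le> K"
    using assms unfolding bloch_space_def bdd_above_def by blast
  have dg: "norm (deriv g z) \<le> \<bar>K\<bar> * (1 - norm z) powr - 1" if "z \<in> disc" for z
    using K[OF that] that powr_mult_le_iff[of "1 - norm z" 1 "norm (deriv g z)" "\<bar>K\<bar>"] by auto
  have "\<exists>M\<ge>0. \<forall>z\<in>disc. norm (1 * deriv g z) \<le> M + \<epsilon> * (1 - norm z) powr - (\<gamma> + 1)"
    if \<epsilon>: "0 < \<epsilon>" for \<epsilon>
  proof -
    obtain M where M: "M \<ge> 0" "\<And>r. r > 0 \<Longrightarrow> \<bar>K\<bar> * r powr - 1 \<le> M + \<epsilon> * r powr - (\<gamma> + 1)"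
      using inverse_le_eps_powr[of \<gamma> "\<bar>K\<bar>" \<epsilon>] assms \<epsilon> by auto
    then show ?thesis
      using order_trans[OF dg M(2)[OF one_minus_norm_pos]] by auto
  qed
  then show ?thesis
    using g assms by (simp add: optimal_domain_little_growth_iff H_disc_def)
qed

section \<open>Scaling and multiplication by bounded functions\<close>

lemma optimal_domain_scale:
  assumes "g \<in> H_disc" "f \<in> optimal_domain g (growth_space \<gamma>)"
  shows "(\<lambda>z. c * f z) \<in> optimal_domain g (growth_space \<gamma>)"
    and "optimal_norm g \<gamma> (\<lambda>z. c * f z) \<le> norm c * optimal_norm g \<gamma> f"
proof -
  have f: "f \<in> H_disc" "volterra g f \<in> growth_space \<gamma>"
    using assms by (auto simp: optimal_domain_def)
  have cf: "(\<lambda>z. c * f z) \<in> H_disc"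
    using f by (auto simp: H_disc_def intro!: holomorphic_intros)
  have bound: "norm (volterra g (\<lambda>z. c * f z) z)
      \<le> norm c * optimal_norm g \<gamma> f * (1 - norm z) powr - \<gamma>" if "z \<in> disc" for z
  proof -
    have "norm (volterra g f z) \<le> optimal_norm g \<gamma> f * (1 - norm z) powr - \<gamma>"
      using growth_norm_le_iff[OF f(2), of "growth_norm \<gamma> (volterra g f)"] that
      by (simp add: optimal_norm_def)
    then show ?thesis
      using volterra_scale[OF f(1) assms(1) that]
      by (simp add: norm_mult mult.assoc mult_left_mono)
  qed
  then have in_growth: "volterra g (\<lambda>z. c * f z) \<in> growth_space \<gamma>"
    using cf assms(1) volterra_in_H_disc unfolding growth_space_iff by blast
  then show "(\<lambda>z. c * f z) \<in> optimal_domain g (growth_space \<gamma>)"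
    using cf by (simp add: optimal_domain_def)
  show "optimal_norm g \<gamma> (\<lambda>z. c * f z) \<le> norm c * optimal_norm g \<gamma> f"
    using bound growth_norm_le_iff[OF in_growth] by (simp add: optimal_norm_def)
qed

text \<open>Pass to f g', where multiplying by \<open>h\<close> costs at most \<open>B\<close>, and
  integrate back. The constant is the product of the Cauchy factor 2 powr (\<gamma> + 1) and the
  integration factor 1/\<gamma>.\<close>

lemma mult_op_optimal_domain:
  assumes "g \<in> H_disc" "0 < \<gamma>" "h \<in> H_disc" "0 \<le> B" "\<And>z. z \<in> disc \<Longrightarrow> norm (h z) \<le> B"
    and f: "f \<in> optimal_domain g (growth_space \<gamma>)"
  shows "mult_op h f \<in> optimal_domain g (growth_space \<gamma>)"
    and "optimal_norm g \<gamma> (mult_op h f) \<le> 2 powr (\<gamma> + 1) / \<gamma> * B * optimal_norm g \<gamma> f"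
proof -
  let ?A = "2 powr (\<gamma> + 1) * B * optimal_norm g \<gamma> f"
  have hf: "mult_op h f \<in> H_disc"
    using assms by (auto simp: mult_op_def optimal_domain_def H_disc_def intro!: holomorphic_intros)
  have "0 \<le> optimal_norm g \<gamma> f"
    using f by (auto simp: optimal_norm_def optimal_domain_def growth_norm_nonneg)
  then have A: "0 \<le> ?A"
    using assms by simp
  have bound: "norm (mult_op h f z * deriv g z) \<le> ?A * (1 - norm z) powr - (\<gamma> + 1)"
    if z: "z \<in> disc" for z
  proof -
    have "norm (h z) * norm (f z * deriv g z)
        \<le> B * (2 powr (\<gamma> + 1) * optimal_norm g \<gamma> f * (1 - norm z) powr - (\<gamma> + 1))"
      using norm_mult_deriv_le_optimal_norm[OF assms(1,2) f z] assms(4) assms(5)[OF z]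
      by (intro mult_mono) auto
    then show ?thesis
      by (simp add: mult_op_def norm_mult mult_ac)
  qed
  show "mult_op h f \<in> optimal_domain g (growth_space \<gamma>)"
    unfolding optimal_domain_growth_iff[OF assms(1,2)] using hf A bound by blast
  show "optimal_norm g \<gamma> (mult_op h f) \<le> 2 powr (\<gamma> + 1) / \<gamma> * B * optimal_norm g \<gamma> f"
    using optimal_norm_le[OF assms(1,2) hf A bound] by simp
qed

lemma mult_op_optimal_domain_little:
  assumes "g \<in> H_disc" "0 < \<gamma>" "h \<in> H_disc" "0 \<le> B" "\<And>z. z \<in> disc \<Longrightarrow> norm (h z) \<le> B"
    and f: "f \<in> optimal_domain g (little_growth_space \<gamma>)"
  shows "mult_op h f \<in> optimal_domain g (little_growth_space \<gamma>)"
  unfolding optimal_domain_little_growth_iff[OF assms(1,2)]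
proof (intro conjI allI impI)
  show "mult_op h f \<in> H_disc"
    using assms by (auto simp: mult_op_def optimal_domain_def H_disc_def intro!: holomorphic_intros)
  fix \<epsilon> :: real
  assume "0 < \<epsilon>"
  \<comment> \<open>Bounding |h| by \<open>B + 1\<close> turns this tolerance back into \<epsilon>
    and avoids division by zero when \<open>B = 0\<close>.\<close>
  then have "0 < \<epsilon> / (B + 1)"
    using assms by simp
  then obtain M where M: "0 \<le> M" "\<And>z. z \<in> disc \<Longrightarrow>
      norm (f z * deriv g z) \<le> M + \<epsilon> / (B + 1) * (1 - norm z) powr - (\<gamma> + 1)"
    using f unfolding optimal_domain_little_growth_iff[OF assms(1,2)] by blast
  have "norm (mult_op h f z * deriv g z) \<le> (B + 1) * M + \<epsilon> * (1 - norm z) powr - (\<gamma> + 1)"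
    if z: "z \<in> disc" for z
  proof -
    have "norm (h z) * norm (f z * deriv g z)
        \<le> (B + 1) * (M + \<epsilon> / (B + 1) * (1 - norm z) powr - (\<gamma> + 1))"
      using M(2)[OF z] assms(4) assms(5)[OF z] by (intro mult_mono) auto
    also have "\<dots> = (B + 1) * M + \<epsilon> * (1 - norm z) powr - (\<gamma> + 1)"
      using \<open>0 \<le> B\<close> by (simp add: distrib_left del: minus_add_distrib)
    finally show ?thesis
      by (simp add: mult_op_def norm_mult mult_ac)
  qed
  then show "\<exists>M\<ge>0. \<forall>z\<in>disc. norm (mult_op h f z * deriv g z)
      \<le> M + \<epsilon> * (1 - norm z) powr - (\<gamma> + 1)"
    using M(1) assms(4) by (intro exI[of _ "(B + 1) * M"]) auto
qed

text \<open>Continuity is tested on norms of differences, and these real suprema are meaningful only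
  for members of the space.\<close>

lemma optimal_domain_diff:
  assumes "g \<in> H_disc" "0 < \<gamma>"
    and "f \<in> optimal_domain g (growth_space \<gamma>)" "f' \<in> optimal_domain g (growth_space \<gamma>)"
  shows "(\<lambda>z. f' z - f z) \<in> optimal_domain g (growth_space \<gamma>)"
proof -
  obtain A A' where A: "0 \<le> A" "0 \<le> A'"
    "\<And>z. z \<in> disc \<Longrightarrow> norm (f z * deriv g z) \<le> A * (1 - norm z) powr - (\<gamma> + 1)"
    "\<And>z. z \<in> disc \<Longrightarrow> norm (f' z * deriv g z) \<le> A' * (1 - norm z) powr - (\<gamma> + 1)"
    using assms(3,4) unfolding optimal_domain_growth_iff[OF assms(1,2)] by blast
  have "norm ((f' z - f z) * deriv g z) \<le> (A' + A) * (1 - norm z) powr - (\<gamma> + 1)"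
    if z: "z \<in> disc" for z
    using norm_triangle_ineq4[of "f' z * deriv g z" "f z * deriv g z"] A(3,4)[OF z]
    by (simp add: left_diff_distrib distrib_right)
  then show ?thesis
    using assms A(1,2) unfolding optimal_domain_growth_iff[OF assms(1,2)]
    by (auto simp: H_disc_def intro!: holomorphic_intros exI[of _ "A' + A"])
qed

section \<open>From bounds on the operator to bounds on its symbol\<close>

text \<open>Homogeneity spreads a bound on a small ball over the whole space. The set
  \<open>X\<close> is kept abstract so that the argument covers both optimal domains.\<close>

lemma optimal_norm_bound_scaling:
  assumes "g \<in> H_disc" "X \<subseteq> optimal_domain g (growth_space \<gamma>)"
    and scale: "\<And>f c. f \<in> X \<Longrightarrow> (\<lambda>z. c * f z) \<in> X"
    and maps: "mult_op h \<in> X \<rightarrow> X"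
    and "0 < \<delta>" and bound: "\<And>f. f \<in> X \<Longrightarrow> optimal_norm g \<gamma> f \<le> \<delta> \<Longrightarrow> optimal_norm g \<gamma> (mult_op h f) \<le> B"
    and f: "f \<in> X"
  shows "optimal_norm g \<gamma> (mult_op h f) \<le> B / \<delta> * optimal_norm g \<gamma> f"
proof -
  let ?N = "optimal_norm g \<gamma>"
  have nonneg: "0 \<le> ?N f" if "f \<in> X" for f
    using that assms(2) by (auto simp: optimal_norm_def optimal_domain_def growth_norm_nonneg)
  have hf: "mult_op h f \<in> X"
    using maps f by auto
  \<comment> \<open>Rescaling by \<delta>/s with \<open>s\<close> strictly above the norm of
    \<open>f\<close> avoids division by a vanishing norm; at the end \<open>s\<close> decreases to
    that norm.\<close>
  have *: "?N (mult_op h f) \<le> B / \<delta> * s" if s: "?N f < s" for s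
  proof -
    have "0 < s" using s nonneg[OF f] by simp
    define t where "t = \<delta> / s"
    have t: "0 < t" using \<open>0 < s\<close> \<open>0 < \<delta>\<close> by (simp add: t_def)
    define u where "u = (\<lambda>z. of_real t * f z)"
    have u: "u \<in> X" "mult_op h u \<in> X"
      using scale[OF f] maps by (auto simp: u_def)
    have "?N u \<le> t * ?N f"
      using optimal_domain_scale(2)[OF assms(1), of f \<gamma> "of_real t"] f assms(2) t
      by (auto simp: u_def)
    also have "\<dots> \<le> t * s" using s t by simp
    also have "t * s = \<delta>" using \<open>0 < s\<close> by (simp add: t_def)
    finally have "?N (mult_op h u) \<le> B"
      using bound u by blast
    moreover have "(\<lambda>z. of_real (1 / t) * mult_op h u z) = mult_op h f"
      using t by (auto simp: u_def mult_op_def)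
    ultimately have "?N (mult_op h f) \<le> 1 / t * B"
      using optimal_domain_scale(2)[OF assms(1), of "mult_op h u" \<gamma> "of_real (1 / t)"] u assms(2) t
        mult_left_mono[of "?N (mult_op h u)" B "1 / t"]
      by (auto simp: norm_divide)
    then show ?thesis
      by (simp add: t_def mult.commute)
  qed
  have "0 \<le> B"
    using bound[of "\<lambda>z. 0 * f z"] scale[OF f, of 0] nonneg maps
      optimal_domain_scale(2)[OF assms(1), of f \<gamma> 0] f assms(2,5)
    by (smt (verit, best) Pi_iff mult_eq_0_iff norm_zero subsetD)
  have "((\<lambda>s. B / \<delta> * s) \<longlongrightarrow> B / \<delta> * ?N f) (at_right (?N f))"
    by (intro tendsto_intros)
  then show ?thesis
    by (rule tendsto_lowerbound) (use * in \<open>auto simp: eventually_at_right_field intro!: exI[of _ "?N f + 1"]\<close>)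
qed

text \<open>By the identity theorem, g' vanishing on a nonempty open set vanishes on the whole disc,
  which would make \<open>g\<close> constant.\<close>

lemma deriv_nonzero_dense:
  assumes "g \<in> H_disc" "\<not> g constant_on disc" "open S" "S \<subseteq> disc" "S \<noteq> {}"
  shows "\<exists>z\<in>S. deriv g z \<noteq> 0"
proof (rule ccontr)
  assume *: "\<not> (\<exists>z\<in>S. deriv g z \<noteq> 0)"
  have g: "g holomorphic_on disc"
    using assms by (simp add: H_disc_def)
  have "deriv g z = 0" if "z \<in> disc" for z
    by (rule analytic_continuation_open[of S disc "deriv g" "\<lambda>_. 0" z])
      (use assms * that g in \<open>auto intro!: holomorphic_intros convex_connected\<close>)
  then have "(g has_field_derivative 0) (at z)" if "z \<in> disc" for z
    using holomorphic_derivI[OF g open_ball that] that by simp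
  then have "\<exists>c. \<forall>z\<in>disc. g z = c"
    by (intro has_field_derivative_zero_constant) (auto intro: has_field_derivative_at_within)
  then show False
    using assms by (simp add: constant_on_def)
qed

text \<open>Comparing geometric rates of h^n and K^n makes every factor independent of n harmless,
  so the bound is \<open>K\<close> itself with no loss of constants.\<close>

lemma norm_le_of_mult_op_bounded:
  assumes "g \<in> H_disc" "\<not> g constant_on disc" "0 < \<gamma>" "h \<in> H_disc"
    and X: "X \<subseteq> optimal_domain g (growth_space \<gamma>)" "(\<lambda>_. 1) \<in> X"
    and maps: "mult_op h \<in> X \<rightarrow> X"
    and "0 \<le> K"
    and bound: "\<And>f. f \<in> X \<Longrightarrow> optimal_norm g \<gamma> (mult_op h f) \<le> K * optimal_norm g \<gamma> f"
    and z: "z \<in> disc"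
  shows "norm (h z) \<le> K"
proof (rule ccontr)
  let ?N = "optimal_norm g \<gamma>"
  assume "\<not> norm (h z) \<le> K"
  have pow: "(\<lambda>w. h w ^ n) \<in> X \<and> ?N (\<lambda>w. h w ^ n) \<le> K ^ n * ?N (\<lambda>_. 1)" for n
  proof (induction n)
    case 0
    then show ?case using X by simp
  next
    case (Suc n)
    have eq: "(\<lambda>w. h w ^ Suc n) = mult_op h (\<lambda>w. h w ^ n)"
      by (simp add: mult_op_def)
    have "?N (\<lambda>w. h w ^ Suc n) \<le> K * (K ^ n * ?N (\<lambda>_. 1))"
      unfolding eq using Suc \<open>0 \<le> K\<close> by (intro order_trans[OF bound]) (auto intro: mult_left_mono)
    then show ?case
      using Suc maps unfolding eq by (auto simp: mult.assoc)
  qed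
  \<comment> \<open>If the claim fails, this set is open and nonempty, hence contains a point where
    g' does not vanish.\<close>
  let ?S = "{w \<in> disc. K < norm (h w)}"
  have "continuous_on disc h"
    using assms by (auto simp: H_disc_def intro: holomorphic_on_imp_continuous_on)
  then have "open (disc \<inter> (\<lambda>w. norm (h w)) -` {K<..})"
    by (intro continuous_open_preimage continuous_intros) auto
  also have "disc \<inter> (\<lambda>w. norm (h w)) -` {K<..} = ?S"
    by auto
  finally have "open ?S" .
  moreover have "z \<in> ?S"
    using z \<open>\<not> norm (h z) \<le> K\<close> by simp
  ultimately obtain w where w: "w \<in> disc" "K < norm (h w)" "deriv g w \<noteq> 0"
    using deriv_nonzero_dense[OF assms(1,2), of ?S] by blast
  define C where "C = 2 powr (\<gamma> + 1) * ?N (\<lambda>_. 1) * (1 - norm w) powr - (\<gamma> + 1)"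
  have pow_le: "norm (h w) ^ n * norm (deriv g w) \<le> C * K ^ n" for n
  proof -
    have "norm (h w ^ n * deriv g w)
        \<le> 2 powr (\<gamma> + 1) * ?N (\<lambda>w. h w ^ n) * (1 - norm w) powr - (\<gamma> + 1)"
      using norm_mult_deriv_le_optimal_norm[OF assms(1,3)] pow X(1) w(1) by blast
    also have "\<dots> \<le> 2 powr (\<gamma> + 1) * (K ^ n * ?N (\<lambda>_. 1)) * (1 - norm w) powr - (\<gamma> + 1)"
      using pow by (intro mult_right_mono mult_left_mono) auto
    finally show ?thesis
      by (simp add: C_def norm_mult norm_power mult_ac)
  qed
  have hw: "0 < norm (h w)" using w \<open>0 \<le> K\<close> by linarith
  \<comment> \<open>After division by |h w|^n the right-hand side decays because K < |h w|, which
    forces g' to vanish at \<open>w\<close>, a contradiction.\<close>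
  have "(\<lambda>n. C * (K / norm (h w)) ^ n) \<longlonglongrightarrow> C * 0"
    using w hw \<open>0 \<le> K\<close> by (intro tendsto_intros LIMSEQ_realpow_zero) auto
  moreover have "norm (deriv g w) \<le> C * (K / norm (h w)) ^ n" for n
    using pow_le[of n] hw by (simp add: power_divide field_simps)
  ultimately have "norm (deriv g w) \<le> C * 0"
    by (intro tendsto_lowerbound[of _ _ sequentially]) auto
  with w show False by simp
qed

lemma mult_op_continuous:
  assumes "g \<in> H_disc" "0 < \<gamma>" "h \<in> H_disc" "0 \<le> B" "\<And>z. z \<in> disc \<Longrightarrow> norm (h z) \<le> B"
    and X: "X \<subseteq> optimal_domain g (growth_space \<gamma>)"
  shows "continuous_op_on X (optimal_norm g \<gamma>) (mult_op h)"
  unfolding continuous_op_on_def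
proof (intro ballI allI impI)
  let ?N = "optimal_norm g \<gamma>"
  fix f and \<epsilon> :: real
  assume f: "f \<in> X" and "0 < \<epsilon>"
  \<comment> \<open>A Lipschitz constant for multiplication by \<open>h\<close>; the radius
    \<epsilon>/(L + 1) used below also makes sense for \<open>L = 0\<close>.\<close>
  define L where "L = 2 powr (\<gamma> + 1) / \<gamma> * B"
  have L: "0 \<le> L" using assms(2,4) by (simp add: L_def)
  have "?N (\<lambda>z. mult_op h f' z - mult_op h f z) < \<epsilon>"
    if f': "f' \<in> X" "?N (\<lambda>z. f' z - f z) < \<epsilon> / (L + 1)" for f'
  proof -
    have d: "(\<lambda>z. f' z - f z) \<in> optimal_domain g (growth_space \<gamma>)"
      using X f f' by (intro optimal_domain_diff assms) auto
    then have nonneg: "0 \<le> ?N (\<lambda>z. f' z - f z)"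
      by (auto simp: optimal_norm_def optimal_domain_def growth_norm_nonneg)
    have "?N (mult_op h (\<lambda>z. f' z - f z)) \<le> L * ?N (\<lambda>z. f' z - f z)"
      unfolding L_def by (intro mult_op_optimal_domain(2) assms d)
    also have "\<dots> \<le> (L + 1) * ?N (\<lambda>z. f' z - f z)"
      using nonneg by (simp add: mult_right_mono)
    also have "\<dots> < \<epsilon>"
      using f'(2) L by (simp add: field_simps)
    finally show ?thesis
      by (simp add: mult_op_def right_diff_distrib)
  qed
  then show "\<exists>\<delta>>0. \<forall>f'\<in>X. ?N (\<lambda>z. f' z - f z) < \<delta> \<longrightarrow> ?N (\<lambda>z. mult_op h f' z - mult_op h f z) < \<epsilon>"
    using L \<open>0 < \<epsilon>\<close> by (intro exI[of _ "\<epsilon> / (L + 1)"]) auto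
qed

text \<open>Continuity at 0 with tolerance 1 bounds the operator on a small ball, scaling makes this
  a bound on all of \<open>X\<close>, and iteration on the constant 1 transfers it to
  \<open>h\<close>.\<close>

lemma mult_op_continuous_imp_bounded:
  assumes "g \<in> H_disc" "\<not> g constant_on disc" "0 < \<gamma>" "h \<in> H_disc"
    and X: "X \<subseteq> optimal_domain g (growth_space \<gamma>)" "(\<lambda>_. 1) \<in> X"
    and scale: "\<And>f c. f \<in> X \<Longrightarrow> (\<lambda>z. c * f z) \<in> X"
    and maps: "mult_op h \<in> X \<rightarrow> X"
    and cont: "continuous_op_on X (optimal_norm g \<gamma>) (mult_op h)"
  shows "h \<in> H_inf"
proof -
  let ?N = "optimal_norm g \<gamma>"
  have "(\<lambda>_. 0) \<in> X"
    using scale[OF X(2), of 0] by simp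
  then obtain \<delta> where \<delta>: "0 < \<delta>" "\<And>f. f \<in> X \<Longrightarrow> ?N f < \<delta> \<Longrightarrow> ?N (mult_op h f) < 1"
    using cont[unfolded continuous_op_on_def, rule_format, of "\<lambda>_. 0" 1]
    by (auto simp: mult_op_def)
  \<comment> \<open>Halving \<delta> replaces the open ball from continuity by the closed one that
    the scaling argument uses.\<close>
  have "?N (mult_op h f) \<le> 1 / (\<delta> / 2) * ?N f" if "f \<in> X" for f
  proof (rule optimal_norm_bound_scaling[OF assms(1) X(1) scale maps])
    fix f assume "f \<in> X" "?N f \<le> \<delta> / 2"
    then show "?N (mult_op h f) \<le> 1"
      using \<delta>(1) \<delta>(2)[of f] by simp
  qed (use that \<delta>(1) in auto)
  then have "norm (h z) \<le> 1 / (\<delta> / 2)" if "z \<in> disc" for z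
    using that \<delta>(1) assms by (intro norm_le_of_mult_op_bounded[OF assms(1-4) X maps]) auto
  then show ?thesis
    using assms(4) unfolding H_inf_def bounded_iff by blast
qed

section \<open>Equivalence of the three properties and of the norms\<close>

lemma norm_le_sup_norm:
  assumes "h \<in> H_inf" "z \<in> disc"
  shows "norm (h z) \<le> sup_norm h"
  unfolding sup_norm_def
  using assms by (intro cSUP_upper) (auto simp: H_inf_def bounded_iff bdd_above_def)

lemma sup_norm_nonneg:
  assumes "h \<in> H_inf"
  shows "0 \<le> sup_norm h"
  using norm_le_sup_norm[OF assms, of 0] order_trans[OF norm_ge_zero] by auto

theorem proposition4p2:
  fixes g :: "complex \<Rightarrow> complex" and \<gamma> :: real
  assumes "g \<in> bloch_space"
    and "\<not> g constant_on disc"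
    and "\<gamma> > 0"
  defines "E \<equiv> optimal_domain g (growth_space \<gamma>)"
    and "E0 \<equiv> optimal_domain g (little_growth_space \<gamma>)"
    and "N \<equiv> optimal_norm g \<gamma>"
  shows "(\<forall>h\<in>H_disc.
            ((mult_op h \<in> E \<rightarrow> E \<and> continuous_op_on E N (mult_op h)) \<longleftrightarrow>
             (mult_op h \<in> E0 \<rightarrow> E0 \<and> continuous_op_on E0 N (mult_op h))) \<and>
            ((mult_op h \<in> E0 \<rightarrow> E0 \<and> continuous_op_on E0 N (mult_op h)) \<longleftrightarrow> h \<in> H_inf)) \<and>
         (\<exists>c>0. \<exists>C>0. \<forall>h\<in>H_inf.
            c * sup_norm h \<le> op_norm_on E N (mult_op h) \<and>
            op_norm_on E N (mult_op h) \<le> C * sup_norm h)"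
proof -
  have g: "g \<in> H_disc"
    using assms by (simp add: bloch_space_def)
  have E0_E: "E0 \<subseteq> E"
    using little_growth_space_subset[OF assms(3)] by (auto simp: E0_def E_def optimal_domain_def)
  have one: "(\<lambda>_. 1) \<in> E0" "(\<lambda>_. 1) \<in> E"
    using one_in_optimal_domain[OF assms(1,3)] E0_E by (auto simp: E0_def)
  have scale: "(\<lambda>z. c * f z) \<in> E" if "f \<in> E" for f c
    using optimal_domain_scale(1)[OF g] that by (simp add: E_def)
  \<comment> \<open>Scaling is multiplication by a constant function, which is a bounded
    symbol.\<close>
  have scale0: "(\<lambda>z. c * f z) \<in> E0" if "f \<in> E0" for f c
    using mult_op_optimal_domain_little[OF g assms(3), of "\<lambda>_. c" "norm c"] that
    by (simp add: E0_def mult_op_def H_disc_def)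
  have H_infD: "h \<in> H_disc" if "h \<in> H_inf" for h
    using that by (simp add: H_inf_def)
  have maps: "mult_op h \<in> E \<rightarrow> E" "mult_op h \<in> E0 \<rightarrow> E0" if h: "h \<in> H_inf" for h
    using mult_op_optimal_domain(1)[OF g assms(3) H_infD[OF h] sup_norm_nonneg[OF h] norm_le_sup_norm[OF h]]
      mult_op_optimal_domain_little[OF g assms(3) H_infD[OF h] sup_norm_nonneg[OF h] norm_le_sup_norm[OF h]]
    by (auto simp: E_def E0_def)
  have cont: "continuous_op_on E N (mult_op h)" "continuous_op_on E0 N (mult_op h)"
    if h: "h \<in> H_inf" for h
    using mult_op_continuous[OF g assms(3) H_infD[OF h] sup_norm_nonneg[OF h] norm_le_sup_norm[OF h]] E0_E
    by (auto simp: N_def E_def)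
  have bdd: "h \<in> H_inf"
    if "h \<in> H_disc" "mult_op h \<in> E \<rightarrow> E" "continuous_op_on E N (mult_op h)" for h
    using mult_op_continuous_imp_bounded[OF g assms(2,3), of h E] that one(2) scale
    by (simp add: N_def E_def)
  have bdd0: "h \<in> H_inf"
    if "h \<in> H_disc" "mult_op h \<in> E0 \<rightarrow> E0" "continuous_op_on E0 N (mult_op h)" for h
    using mult_op_continuous_imp_bounded[OF g assms(2,3), of h E0] that one(1) scale0 E0_E
    by (simp add: N_def E_def)
  define C where "C = 2 powr (\<gamma> + 1) / \<gamma>"
  have C: "0 < C"
    using assms(3) by (simp add: C_def)
  \<comment> \<open>The lower constant can be 1 because the iteration argument bounds |h| by the
    operator norm exactly.\<close>
  have norms: "1 * sup_norm h \<le> op_norm_on E N (mult_op h) \<and>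
      op_norm_on E N (mult_op h) \<le> C * sup_norm h" if h: "h \<in> H_inf" for h
  proof -
    let ?U = "{f \<in> E. N f \<le> 1}"
    have Nh: "N (mult_op h f) \<le> C * sup_norm h" if f: "f \<in> ?U" for f
    proof -
      have "N (mult_op h f) \<le> C * sup_norm h * N f"
        unfolding C_def N_def using f
        by (intro mult_op_optimal_domain(2)[OF g assms(3) H_infD[OF h] sup_norm_nonneg[OF h] norm_le_sup_norm[OF h]])
           (auto simp: E_def)
      also have "\<dots> \<le> C * sup_norm h * 1"
        using f C sup_norm_nonneg[OF h] by (intro mult_left_mono) auto
      finally show ?thesis by simp
    qed
    \<comment> \<open>The unit ball must be nonempty for its supremum to inherit an upper
      bound.\<close>
    have zero: "(\<lambda>_. 0) \<in> ?U"
      using scale[OF one(2), of 0] optimal_domain_scale(2)[OF g, of "\<lambda>_. 1" \<gamma> 0] one(2)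
      by (simp add: N_def E_def)
    have upper: "op_norm_on E N (mult_op h) \<le> C * sup_norm h"
      unfolding op_norm_on_def using zero Nh by (intro cSUP_least) auto
    have le_op: "N (mult_op h f) \<le> op_norm_on E N (mult_op h)" if "f \<in> ?U" for f
      unfolding op_norm_on_def using Nh that by (intro cSUP_upper) (auto simp: bdd_above_def)
    have "mult_op h (\<lambda>_. 0) \<in> E"
      using zero maps(1)[OF h] by auto
    then have "0 \<le> N (mult_op h (\<lambda>_. 0))"
      by (auto simp: N_def E_def optimal_norm_def optimal_domain_def growth_norm_nonneg)
    then have nonneg: "0 \<le> op_norm_on E N (mult_op h)"
      using le_op[OF zero] by simp
    \<comment> \<open>The scaling argument with \<delta> = 1, whose ball is the one defining the
      operator norm.\<close>
    have "N (mult_op h f) \<le> op_norm_on E N (mult_op h) / 1 * N f" if "f \<in> E" for f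
      unfolding N_def
      by (rule optimal_norm_bound_scaling[OF g, of E])
        (use that maps(1)[OF h] scale le_op in \<open>auto simp: E_def N_def\<close>)
    then have "norm (h z) \<le> op_norm_on E N (mult_op h)" if "z \<in> disc" for z
      using that one(2) maps(1)[OF h] nonneg
      by (intro norm_le_of_mult_op_bounded[OF g assms(2,3) H_infD[OF h], of E]) (auto simp: E_def N_def)
    then have "sup_norm h \<le> op_norm_on E N (mult_op h)"
      unfolding sup_norm_def by (intro cSUP_least) auto
    with upper show ?thesis by simp
  qed
  have "\<exists>c>0. \<exists>C>0. \<forall>h\<in>H_inf. c * sup_norm h \<le> op_norm_on E N (mult_op h) \<and>
      op_norm_on E N (mult_op h) \<le> C * sup_norm h"
    using C norms zero_less_one by blast
  then show ?thesis
    using maps cont bdd bdd0 by blast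
qed

end
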